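(* Let $d \ge 0$ and $p \ge 1$ be integers and let $h \in \mathbb{R}^{p(d+1)}$. For $r \in \{0,1,\dots,p-2\}$ and $\ell \in \{0,1,\dots,d\}$ set $$A^{(\ell)}_r(h) := \sum_{j=0}^d (-j)^\ell h_{r+1,j} - \sum_{j=0}^d (-j)^\ell h_{r,j},$$ and for $\ell \in \{0,1,\dots,d\}$ set $$B^{(\ell)}(h) := \sum_{j=0}^d (-j)^\ell h_{0,j} - \sum_{j=0}^d (-j-1)^\ell h_{p-1,j}$$ (with the convention $0^0=1$). Then $h \in C_{\mathrm{END}}$ if and only if both of the following hold: 1. for each $r \in \{0,\dots,p-2\}$, either $A^{(\ell)}_r(h) = 0$ for all $\ell \in \{0,\dots,d\}$, or the smallest $\ell \in \{0,\dots,d\}$ for which $A^{(\ell)}_r(h) \neq 0$ satisfies $A^{(\ell)}_r(h) > 0$; and 2. either $B^{(\ell)}(h) = 0$ for all $\ell \in \{0,\dots,d\}$, or the smallest $\ell \in \{0,\dots,d\}$ for which $B^{(\ell)}(h) \neq 0$ satisfies $B^{(\ell)}(h) > 0$.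
   Context: A vector $h \in \mathbb{R}^{p(d+1)}$ is indexed as $h = (h_0, h_1, \dots, h_{p(d+1)-1})$, and we write $h_{r,j} := h_{jp+r}$ for $0 \le r \le p-1$ and $0 \le j \le d$. Put $h(z) := \sum_i h_i z^i$ and define $L_h : \mathbb{Z}_{\ge 0} \to \mathbb{R}$ by $\sum_{n \ge 0} L_h(n) z^n := h(z)/(1-z^p)^{d+1}$; equivalently, $L_h(tp+r) = \sum_{j=0}^d h_{r,j}\binom{t+d-j}{d}$ for $t \ge 0$, $0 \le r \le p-1$. For $N \in \mathbb{Z}_{\ge 0}$, let $C_N := \{h \in \mathbb{R}^{p(d+1)} : L_h(n+1) \ge L_h(n) \text{ for all integers } n \ge N\}$. The eventually nondecreasing cone is $C_{\mathrm{END}} := \bigcup_{N \ge 0} C_N$. *)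

theory Defs
  imports "HOL-Analysis.Analysis" "HOL-Computational_Algebra.Formal_Power_Series"
    "Jordan_Normal_Form.Matrix"
begin

text \<open>
  The ambient space of vectors with \<open>p * (d + 1)\<close> real entries, indexed from 0, is
  \<open>carrier_vec (p * (d + 1))\<close>. In what follows \<open>p \<ge> 1\<close> is intended; then
  \<open>(1 - fps_X ^ p) ^ (d + 1)\<close> has constant term 1 and is a unit of the power series ring.
\<close>

definition h_entry :: "nat \<Rightarrow> real vec \<Rightarrow> nat \<Rightarrow> nat \<Rightarrow> real" where
  "h_entry p h r j = h $ (j * p + r)"

definition h_series :: "real vec \<Rightarrow> real fps" where
  "h_series h = (\<Sum>i<dim_vec h. fps_const (h $ i) * fps_X ^ i)"

definition L :: "nat \<Rightarrow> nat \<Rightarrow> real vec \<Rightarrow> nat \<Rightarrow> real" where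
  "L d p h n = fps_nth (h_series h / (1 - fps_X ^ p) ^ (d + 1)) n"

definition C_from :: "nat \<Rightarrow> nat \<Rightarrow> nat \<Rightarrow> real vec set" where
  "C_from d p N = {h \<in> carrier_vec (p * (d + 1)). \<forall>n\<ge>N. L d p h (n + 1) \<ge> L d p h n}"

definition C_END :: "nat \<Rightarrow> nat \<Rightarrow> real vec set" where
  "C_END d p = (\<Union>N. C_from d p N)"

definition A_coef :: "nat \<Rightarrow> nat \<Rightarrow> nat \<Rightarrow> nat \<Rightarrow> real vec \<Rightarrow> real" where
  "A_coef d p r l h =
     (\<Sum>j=0..d. (- real j) ^ l * h_entry p h (r + 1) j)
   - (\<Sum>j=0..d. (- real j) ^ l * h_entry p h r j)"

definition B_coef :: "nat \<Rightarrow> nat \<Rightarrow> nat \<Rightarrow> real vec \<Rightarrow> real" where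
  "B_coef d p l h =
     (\<Sum>j=0..d. (- real j) ^ l * h_entry p h 0 j)
   - (\<Sum>j=0..d. (- real j - 1) ^ l * h_entry p h (p - 1) j)"

end

theory Submission
  imports Defs
begin

text \<open>
  On each residue class modulo \<open>p\<close>, the difference \<open>L(n + 1) - L(n)\<close> is eventually a polynomial
  in \<open>t\<close> of the form \<open>\<Sum>i. w i * \<phi>(t + a i)\<close>, where \<open>\<phi>(t)\<close> is the binomial coefficient of
  \<open>t + d\<close> over \<open>d\<close>, of degree \<open>d\<close>. Its coefficient at \<open>t^k\<close> is a combination of the moments
  \<open>M l = (\<Sum>i. w i * a i ^ l)\<close> with \<open>l \<le> d - k\<close>, in which \<open>M (d - k)\<close> has a positive factor.
  Hence the first nonvanishing moment is, up to a positive factor, the leading coefficient,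
  which decides the eventual sign. The moments are the numbers \<open>A\<close> and \<open>B\<close>.
\<close>

section \<open>Shifted polynomials and eventual signs\<close>

text \<open>Binomial theorem for \<open>[:a, 1:] ^ m\<close>. The truncated exponent
  \<open>m - k\<close> is harmless, since \<open>m choose k\<close> vanishes when \<open>k\<close>
  exceeds \<open>m\<close>.\<close>

lemma coeff_pcompose_shift:
  fixes q :: "'a::comm_semiring_1 poly"
  shows "coeff (q \<circ>\<^sub>p [:a, 1:]) k = (\<Sum>m\<le>degree q. coeff q m * of_nat (m choose k) * a ^ (m - k))"
proof -
  have "coeff ([:a, 1:] ^ m) k = of_nat (m choose k) * a ^ (m - k)" for m
  proof (cases "k \<le> m")
    case True
    then show ?thesis by (simp add: coeff_linear_poly_power)
  next
    case False
    have "degree ([:a, 1:] ^ m) \<le> m"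
      using degree_power_le[of "[:a, 1:]" m] by simp
    with False show ?thesis by (simp add: coeff_eq_0 binomial_eq_0)
  qed
  then show ?thesis
    by (simp add: pcompose_altdef poly_altdef coeff_sum coeff_map_poly degree_map_poly mult.assoc)
qed

text \<open>Exchanging the two sums isolates the power sums of the shifts, so the weights enter each
  coefficient only through their moments.\<close>

lemma coeff_sum_shifts:
  fixes q :: "real poly"
  shows "coeff (\<Sum>i\<in>I. Polynomial.smult (w i) (q \<circ>\<^sub>p [:a i, 1:])) k =
    (\<Sum>m\<le>degree q. coeff q m * of_nat (m choose k) * (\<Sum>i\<in>I. a i ^ (m - k) * w i))"
  unfolding coeff_sum coeff_smult coeff_pcompose_shift sum_distrib_left
  by (subst sum.swap) (simp add: mult_ac)

lemma eventually_poly_nonneg_iff: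
  fixes Q :: "real poly"
  shows "(\<forall>\<^sub>F t in sequentially. poly Q (real t) \<ge> 0) \<longleftrightarrow> Q = 0 \<or> lead_coeff Q > 0"
proof -
  have pos: "\<forall>\<^sub>F t in sequentially. poly R (real t) > 0" if R: "lead_coeff R > 0" for R :: "real poly"
  proof -
    obtain x0 where "\<forall>x\<ge>x0. poly R x \<ge> lead_coeff R"
      using poly_pinfty_gt_lc[OF R] by blast
    moreover have "\<forall>\<^sub>F t in sequentially. real t \<ge> x0"
      using filterlim_real_sequentially by (simp add: filterlim_at_top)
    ultimately show ?thesis
      using R by (auto elim!: eventually_mono intro: less_le_trans)
  qed
  show ?thesis
  proof
    assume nonneg: "\<forall>\<^sub>F t in sequentially. poly Q (real t) \<ge> 0"
    have "\<not> lead_coeff Q < 0"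
    proof
      assume "lead_coeff Q < 0"
      then have "\<forall>\<^sub>F t in sequentially. poly (- Q) (real t) > 0"
        by (intro pos) simp
      with nonneg have "\<forall>\<^sub>F t :: nat in sequentially. False"
        by eventually_elim simp
      then show False by simp
    qed
    then show "Q = 0 \<or> lead_coeff Q > 0"
      by (metis leading_coeff_0_iff linorder_neqE)
  next
    assume "Q = 0 \<or> lead_coeff Q > 0"
    then show "\<forall>\<^sub>F t in sequentially. poly Q (real t) \<ge> 0"
      by (auto dest!: pos elim!: eventually_mono)
  qed
qed

text \<open>\<open>M\<close> stays abstract, constrained only through \<open>coeffs\<close>, so that
  the same argument serves both \<open>A_coef\<close> and \<open>B_coef\<close>.\<close>

lemma eventually_nonneg_iff_first_moment:
  fixes Q \<phi> :: "real poly" and M :: "nat \<Rightarrow> real"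
  assumes deg: "degree \<phi> = d" and lc: "lead_coeff \<phi> > 0"
    and coeffs: "\<And>k. coeff Q k = (\<Sum>m\<le>d. coeff \<phi> m * of_nat (m choose k) * M (m - k))"
  shows "(\<forall>\<^sub>F t in sequentially. poly Q (real t) \<ge> 0) \<longleftrightarrow>
    (\<forall>l\<le>d. M l = 0) \<or> M (LEAST l. l \<le> d \<and> M l \<noteq> 0) > 0"
proof (cases "\<forall>l\<le>d. M l = 0")
  case True
  then have "Q = 0"
    by (intro poly_eqI) (auto simp: coeffs intro!: sum.neutral)
  with True show ?thesis by simp
next
  case False
  define l where "l = (LEAST l. l \<le> d \<and> M l \<noteq> 0)"
  have l: "l \<le> d" "M l \<noteq> 0"
    using False LeastI_ex[of "\<lambda>l. l \<le> d \<and> M l \<noteq> 0"] by (auto simp: l_def)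
  have below: "M i = 0" if "i < l" for i
    using not_less_Least[of i "\<lambda>l. l \<le> d \<and> M l \<noteq> 0"] that l(1) by (auto simp: l_def)
  \<comment> \<open>For \<open>m < k\<close> the binomial coefficient is zero; otherwise
    \<open>m - k \<le> d - k < l\<close>, and the moment is zero.\<close>
  have upper: "coeff Q k = 0" if "k > d - l" for k
    unfolding coeffs using that l(1)
    by (intro sum.neutral) (auto intro!: below)
  have "coeff Q (d - l) = (\<Sum>m\<in>{d}. coeff \<phi> m * of_nat (m choose (d - l)) * M (m - (d - l)))"
    unfolding coeffs
  proof (intro sum.mono_neutral_right ballI)
    fix m assume "m \<in> {..d} - {d}"
    \<comment> \<open>The first alternative kills the binomial coefficient, the second the moment;
      only \<open>m = d\<close> survives, with moment \<open>M l\<close>.\<close>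
    then have "m < d - l \<or> m - (d - l) < l" using l(1) by auto
    then show "coeff \<phi> m * of_nat (m choose (d - l)) * M (m - (d - l)) = 0"
      by (auto simp: below)
  qed auto
  then have top: "coeff Q (d - l) = lead_coeff \<phi> * of_nat (d choose (d - l)) * M l"
    using l(1) by (simp add: deg)
  have binom: "0 < lead_coeff \<phi> * real (d choose (d - l))"
    using lc by simp
  have nz: "coeff Q (d - l) \<noteq> 0"
    using top binom l(2) by (metis less_irrefl mult_eq_0_iff)
  then have "degree Q = d - l"
    by (meson antisym_conv degree_le le_degree upper)
  then have "Q = 0 \<or> lead_coeff Q > 0 \<longleftrightarrow> M l > 0"
    using nz top zero_less_mult_iff[of _ "M l"] binom by (metis coeff_0 less_asym)
  with False show ?thesis
    unfolding eventually_poly_nonneg_iff l_def by blast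
qed

section \<open>The binomial polynomial and the generating function of \<open>L\<close>\<close>

text \<open>The absorption identity for binomial coefficients yields the polynomial for
  \<open>Suc d\<close> from the one for \<open>d\<close>: multiply by the linear factor
  \<open>x + d + 1\<close> and divide by \<open>d + 1\<close>.\<close>

lemma binomial_poly_exists:
  "\<exists>\<phi> :: real poly. degree \<phi> = d \<and> lead_coeff \<phi> > 0 \<and>
    (\<forall>n. poly \<phi> (real n) = real ((n + d) choose d))"
proof (induction d)
  case 0
  show ?case by (rule exI[of _ 1]) simp
next
  case (Suc d)
  then obtain \<phi> :: "real poly" where \<phi>: "degree \<phi> = d" "lead_coeff \<phi> > 0"
    "\<And>n. poly \<phi> (real n) = real ((n + d) choose d)" by blast
  define \<psi> where "\<psi> = Polynomial.smult (1 / real (Suc d)) ([:real (Suc d), 1:] * \<phi>)"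
  have "\<phi> \<noteq> 0" using \<phi>(2) by auto
  then have "degree \<psi> = Suc d"
    using \<phi>(1) unfolding \<psi>_def by (simp add: degree_mult_eq del: mult_pCons_left)
  moreover have "lead_coeff \<psi> > 0"
    using \<phi>(2) unfolding \<psi>_def lead_coeff_smult lead_coeff_mult by simp
  moreover have "poly \<psi> (real n) = real ((n + Suc d) choose (Suc d))" for n
  proof -
    have "real (Suc d) * real (Suc (n + d) choose Suc d) =
        real (Suc (n + d)) * real ((n + d) choose d)"
      unfolding of_nat_mult[symmetric] Suc_times_binomial_eq by (simp only: mult.commute)
    then show ?thesis
      by (simp add: \<psi>_def \<phi>(3) field_simps del: mult_pCons_left binomial_Suc_Suc)
  qed
  ultimately show ?case by blast
qed

text \<open>Each factor \<open>1 - fps_X ^ p\<close> lowers the parameter of the claimed series by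
  one, and the last one turns the geometric series in \<open>fps_X ^ p\<close> into 1.\<close>

lemma inverse_one_minus_fps_X_power:
  assumes "p \<ge> 1"
  shows "inverse ((1 - fps_X ^ p) ^ Suc d :: real fps) =
    Abs_fps (\<lambda>n. if p dvd n then real ((n div p + d) choose d) else 0)"
proof (rule fps_inverse_unique)
  let ?G = "\<lambda>d. Abs_fps (\<lambda>n. if p dvd n then real ((n div p + d) choose d) else 0)"
  have base: "?G 0 * (1 - fps_X ^ p) = 1"
    using assms
    by (intro fps_ext) (auto simp: right_diff_distrib fps_X_power_mult_right_nth not_less
        dvd_minus_self dest: dvd_imp_le)
  have step: "?G (Suc d) * (1 - fps_X ^ p) = ?G d" for d
  proof (rule fps_ext)
    fix n
    show "fps_nth (?G (Suc d) * (1 - fps_X ^ p)) n = fps_nth (?G d) n"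
    proof (cases "p dvd n")
      case False
      then show ?thesis
        by (auto simp: right_diff_distrib fps_X_power_mult_right_nth dvd_minus_self)
    next
      case True
      then obtain k where k: "n = p * k" by blast
      show ?thesis
      \<comment> \<open>At \<open>k = 0\<close> the shifted series contributes nothing; for
        \<open>k = Suc m\<close> the difference of neighbouring coefficients is Pascal's
        rule.\<close>
      proof (cases k)
        case 0
        with k assms show ?thesis
          by (simp add: right_diff_distrib fps_X_power_mult_right_nth)
      next
        case (Suc m)
        then have "n - p = p * m" "\<not> n < p" by (auto simp: k)
        with k Suc assms show ?thesis
          by (simp add: right_diff_distrib fps_X_power_mult_right_nth)
      qed
    qed
  qed
  have "?G d * (1 - fps_X ^ p) ^ Suc d = 1"
  proof (induction d)
    case 0
    show ?case using base by simp
  next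
    case (Suc d)
    then show ?case
      unfolding power_Suc[of _ "Suc d"] mult.assoc[symmetric] step .
  qed
  then show "(1 - fps_X ^ p) ^ Suc d * ?G d = 1"
    by (simp only: mult.commute)
qed

text \<open>Read off the Cauchy product with the inverse series. The bound \<open>t \<ge> d\<close>
  makes every \<open>t - j\<close> a genuine difference, which is enough for eventual
  statements.\<close>

lemma L_eq:
  assumes p: "p \<ge> 1" and h: "h \<in> carrier_vec (p * (d + 1))" and r: "r < p" and t: "t \<ge> d"
  shows "L d p h (t * p + r) = (\<Sum>j=0..d. h_entry p h r j * real ((t - j + d) choose d))"
proof -
  define n where "n = t * p + r"
  define G where "G = Abs_fps (\<lambda>n. if p dvd n then real ((n div p + d) choose d) else 0)"
  have dim: "dim_vec h = p * (d + 1)" using h by simp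
  have unit: "fps_nth ((1 - fps_X ^ p) ^ Suc d :: real fps) 0 \<noteq> 0"
    using p unfolding fps_power_zeroth by simp
  have "L d p h n = fps_nth (h_series h * G) n"
    unfolding L_def Suc_eq_plus1[symmetric] fps_divide_unit[OF unit]
      inverse_one_minus_fps_X_power[OF p] G_def ..
  also have "\<dots> = (\<Sum>i<dim_vec h. if n < i then 0 else h $ i * fps_nth G (n - i))"
    unfolding h_series_def sum_distrib_right fps_sum_nth mult.assoc fps_mult_left_const_nth
      fps_X_power_mult_nth by (intro sum.cong) auto
  \<comment> \<open>\<open>G\<close> is supported on multiples of \<open>p\<close>, so only indices
    congruent to \<open>r\<close> modulo \<open>p\<close> contribute.\<close>
  also have "\<dots> = (\<Sum>i\<in>(\<lambda>j. j * p + r) ` {0..d}. if n < i then 0 else h $ i * fps_nth G (n - i))"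
  proof (rule sum.mono_neutral_right)
    show "(\<lambda>j. j * p + r) ` {0..d} \<subseteq> {..<dim_vec h}"
    proof safe
      fix j assume "j \<in> {0..d}"
      then have "j * p \<le> d * p" by simp
      then have "j * p + r < d * p + p" using r by (rule add_le_less_mono)
      then show "j * p + r < dim_vec h" by (simp add: dim algebra_simps)
    qed
    show "\<forall>i\<in>{..<dim_vec h} - (\<lambda>j. j * p + r) ` {0..d}.
      (if n < i then 0 else h $ i * fps_nth G (n - i)) = 0"
    proof
      fix i assume i: "i \<in> {..<dim_vec h} - (\<lambda>j. j * p + r) ` {0..d}"
      have "i div p \<le> d"
        using i by (simp add: dim mult.commute less_mult_imp_div_less flip: less_Suc_eq_le)
      moreover have "i = i div p * p + i mod p" by simp
      ultimately have "i mod p \<noteq> r"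
        using i by (metis Diff_iff atLeastAtMost_iff image_eqI zero_le)
      moreover have "n mod p = r" using r by (simp add: n_def)
      ultimately have "\<not> p dvd n - i" if "\<not> n < i"
        using that mod_eq_dvd_iff_nat[of i n p] by simp
      then show "(if n < i then 0 else h $ i * fps_nth G (n - i)) = 0"
        by (simp add: G_def)
    qed
  qed simp
  also have "\<dots> = (\<Sum>j=0..d. if n < j * p + r then 0
      else h $ (j * p + r) * fps_nth G (n - (j * p + r)))"
    using p by (subst sum.reindex) (auto simp: inj_on_def)
  also have "\<dots> = (\<Sum>j=0..d. h_entry p h r j * real ((t - j + d) choose d))"
  proof (rule sum.cong)
    fix j assume "j \<in> {0..d}"
    with t have "j \<le> t" by simp
    moreover have "n - (j * p + r) = (t - j) * p" by (simp add: n_def diff_mult_distrib)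
    ultimately show "(if n < j * p + r then 0 else h $ (j * p + r) * fps_nth G (n - (j * p + r))) =
        h_entry p h r j * real ((t - j + d) choose d)"
      using p by (simp add: G_def h_entry_def n_def)
  qed simp
  finally show ?thesis by (simp add: n_def)
qed

section \<open>Residue classes and the sign criterion\<close>

text \<open>There are finitely many classes, so a common threshold \<open>N\<close> for
  \<open>t\<close> exists; it becomes the threshold \<open>N * p\<close> for
  \<open>n\<close>.\<close>

lemma eventually_iff_residue_classes:
  assumes "p \<ge> 1"
  shows "eventually P sequentially \<longleftrightarrow> (\<forall>r<p. \<forall>\<^sub>F t in sequentially. P (t * p + r))"
proof
  assume "eventually P sequentially"
  moreover have "filterlim (\<lambda>t. t * p + r) sequentially sequentially" for r
    using assms by (intro filterlim_subseq) (auto simp: strict_mono_def)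
  ultimately show "\<forall>r<p. \<forall>\<^sub>F t in sequentially. P (t * p + r)"
    by (auto simp: filterlim_iff)
next
  assume "\<forall>r<p. \<forall>\<^sub>F t in sequentially. P (t * p + r)"
  then have "\<forall>\<^sub>F t in sequentially. \<forall>r\<in>{..<p}. P (t * p + r)"
    by (intro eventually_ball_finite) auto
  then obtain N where N: "\<And>t r. t \<ge> N \<Longrightarrow> r < p \<Longrightarrow> P (t * p + r)"
    by (auto simp: eventually_sequentially)
  have "P n" if "n \<ge> N * p" for n
  proof -
    have "n div p \<ge> N" using that assms by (simp add: less_eq_div_iff_mult_less_eq)
    with N[of "n div p" "n mod p"] assms show ?thesis by simp
  qed
  then show "eventually P sequentially" by (auto simp: eventually_sequentially)
qed

theorem theorem3p1:
  fixes d p :: nat and h :: "real vec"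
  assumes "p \<ge> 1" and "h \<in> carrier_vec (p * (d + 1))"
  shows "h \<in> C_END d p \<longleftrightarrow>
    (\<forall>r<p - 1. (\<forall>l\<le>d. A_coef d p r l h = 0) \<or>
       A_coef d p r (LEAST l. l \<le> d \<and> A_coef d p r l h \<noteq> 0) h > 0) \<and>
    ((\<forall>l\<le>d. B_coef d p l h = 0) \<or>
       B_coef d p (LEAST l. l \<le> d \<and> B_coef d p l h \<noteq> 0) h > 0)"
proof -
  obtain \<phi> :: "real poly" where \<phi>: "degree \<phi> = d" "lead_coeff \<phi> > 0"
    "\<And>n. poly \<phi> (real n) = real ((n + d) choose d)"
    using binomial_poly_exists[of d] by blast
  \<comment> \<open>The offset \<open>b\<close> moves the origin of the variable:
    \<open>F r b\<close> at \<open>t - b\<close> gives the value of \<open>L\<close> in block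
    \<open>t\<close>. The choice \<open>b = 0\<close> fits \<open>A_coef\<close>;
    \<open>b = - 1\<close> produces the powers of \<open>- j - 1\<close> in
    \<open>B_coef\<close>.\<close>
  define F where "F r b = (\<Sum>j=0..d.
      Polynomial.smult (h_entry p h r j) (\<phi> \<circ>\<^sub>p [:- real j + b, 1:]))" for r b
  have coeff_F: "coeff (F r b) k = (\<Sum>m\<le>d. coeff \<phi> m * of_nat (m choose k) *
      (\<Sum>j=0..d. (- real j + b) ^ (m - k) * h_entry p h r j))" for r b k
    unfolding F_def coeff_sum_shifts \<phi>(1) ..
  have L_F: "L d p h (t * p + r) = poly (F r b) (real t - b)" if "r < p" "t \<ge> d" for r t b
    unfolding L_eq[OF assms that] F_def poly_sum
  proof (rule sum.cong)
    fix j assume "j \<in> {0..d}"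
    \<comment> \<open>The offsets cancel, and \<open>j \<le> d \<le> t\<close> makes the argument a
      natural number, where \<open>\<phi>\<close> is known.\<close>
    then have "- real j + b + (real t - b) = real (t - j)" using that by simp
    then show "h_entry p h r j * real ((t - j + d) choose d) =
        poly (Polynomial.smult (h_entry p h r j) (\<phi> \<circ>\<^sub>p [:- real j + b, 1:])) (real t - b)"
      by (simp only: poly_smult poly_pcompose poly_pCons poly_0 mult_zero_right add_0_right
          mult_1_right \<phi>(3))
  qed simp
  let ?inc = "\<lambda>n. L d p h n \<le> L d p h (n + 1)"
  have A: "(\<forall>\<^sub>F t in sequentially. ?inc (t * p + r)) \<longleftrightarrow>
      (\<forall>l\<le>d. A_coef d p r l h = 0) \<or>
       A_coef d p r (LEAST l. l \<le> d \<and> A_coef d p r l h \<noteq> 0) h > 0" if "r < p - 1" for r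
  proof -
    have "\<forall>\<^sub>F t in sequentially. ?inc (t * p + r) \<longleftrightarrow> poly (F (r + 1) 0 - F r 0) (real t) \<ge> 0"
      using eventually_ge_at_top[of d]
    proof eventually_elim
      case (elim t)
      then show ?case
        using that L_F[of r t 0] L_F[of "r + 1" t 0] by (simp add: add.assoc)
    qed
    then have "(\<forall>\<^sub>F t in sequentially. ?inc (t * p + r)) \<longleftrightarrow>
        (\<forall>\<^sub>F t in sequentially. poly (F (r + 1) 0 - F r 0) (real t) \<ge> 0)"
      by (rule eventually_subst)
    also have "\<dots> \<longleftrightarrow> (\<forall>l\<le>d. A_coef d p r l h = 0) \<or>
       A_coef d p r (LEAST l. l \<le> d \<and> A_coef d p r l h \<noteq> 0) h > 0"
      by (rule eventually_nonneg_iff_first_moment[OF \<phi>(1,2)])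
        (simp add: coeff_F A_coef_def right_diff_distrib sum_subtractf)
    finally show ?thesis .
  qed
  have B: "(\<forall>\<^sub>F t in sequentially. ?inc (t * p + (p - 1))) \<longleftrightarrow>
      (\<forall>l\<le>d. B_coef d p l h = 0) \<or>
       B_coef d p (LEAST l. l \<le> d \<and> B_coef d p l h \<noteq> 0) h > 0"
  proof -
    \<comment> \<open>The successor of \<open>t * p + (p - 1)\<close> lies in block \<open>t + 1\<close>; taking \<open>t + 1\<close> as the variable
      gives the shift \<open>- 1\<close> in the second sum of \<open>B\<close>.\<close>
    have "\<forall>\<^sub>F t in sequentially. ?inc (t * p + (p - 1)) \<longleftrightarrow>
        poly (F 0 0 - F (p - 1) (- 1)) (real (Suc t)) \<ge> 0"
      using eventually_ge_at_top[of d]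
    proof eventually_elim
      case (elim t)
      \<comment> \<open>The summand 0 is kept so that the right side matches \<open>L_F\<close> with
        residue 0.\<close>
      have "t * p + (p - 1) + 1 = Suc t * p + 0" using assms(1) by simp
      then show ?case
        using elim assms(1) L_F[of "p - 1" t "- 1"] L_F[of 0 "Suc t" 0]
        by (simp only: poly_diff) (simp add: add.commute)
    qed
    then have "(\<forall>\<^sub>F t in sequentially. ?inc (t * p + (p - 1))) \<longleftrightarrow>
        (\<forall>\<^sub>F t in sequentially. poly (F 0 0 - F (p - 1) (- 1)) (real (Suc t)) \<ge> 0)"
      by (rule eventually_subst)
    also have "\<dots> \<longleftrightarrow> (\<forall>\<^sub>F t in sequentially. poly (F 0 0 - F (p - 1) (- 1)) (real t) \<ge> 0)"
      by (rule eventually_sequentially_Suc)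
    also have "\<dots> \<longleftrightarrow> (\<forall>l\<le>d. B_coef d p l h = 0) \<or>
       B_coef d p (LEAST l. l \<le> d \<and> B_coef d p l h \<noteq> 0) h > 0"
      by (rule eventually_nonneg_iff_first_moment[OF \<phi>(1,2)])
        (simp add: coeff_F B_coef_def right_diff_distrib sum_subtractf)
    finally show ?thesis .
  qed
  have "h \<in> C_END d p \<longleftrightarrow> eventually ?inc sequentially"
    using assms(2) by (auto simp: C_END_def C_from_def eventually_sequentially)
  also have "\<dots> \<longleftrightarrow> (\<forall>r<p. \<forall>\<^sub>F t in sequentially. ?inc (t * p + r))"
    by (rule eventually_iff_residue_classes[OF assms(1)])
  also have "\<dots> \<longleftrightarrow> (\<forall>r<p - 1. \<forall>\<^sub>F t in sequentially. ?inc (t * p + r)) \<and>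
      (\<forall>\<^sub>F t in sequentially. ?inc (t * p + (p - 1)))"
    using assms(1) less_Suc_eq[of _ "p - 1"] by auto
  finally show ?thesis using A B by simp
qed

end
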